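(* For every integer $k\ge1$, $$\frac{\sum_{n\in\mathbb{Z}}\mathrm{sgn}(n)\,q^{(k+1)n^2+kn}}{(q)_\infty^{2k}}=\sum_{n_1,n_2,\dots,n_{2k-1}\ge0}\frac{q^{\sum_{i=1}^{2k-2}n_in_{i+1}+\sum_{i=1}^{2k-1}n_i}}{(q)_{n_1}^2(q)_{n_2}^2\cdots(q)_{n_{2k-1}}^2}.$$
   Context: Here $|q|<1$; $\mathrm{sgn}(n):=1$ for $n\ge0$ and $\mathrm{sgn}(n):=-1$ for $n<0$; $(q)_n:=\prod_{j=1}^n(1-q^j)$ for $n\ge0$ and $(q)_\infty:=\prod_{j\ge1}(1-q^j)$. *)

theory Defs
  imports "HOL-Analysis.Analysis"
begin

(* Differs from the library's sgn at 0, where the value is 1. *)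
definition sg :: "int \<Rightarrow> complex" where
  "sg n = (if n \<ge> 0 then 1 else - 1)"

definition qfac :: "complex \<Rightarrow> nat \<Rightarrow> complex" where
  "qfac q n = (\<Prod>j = 1..n. 1 - q ^ j)"

(* The library's infinite products start at index 0, hence the shift. *)
definition qfac_inf :: "complex \<Rightarrow> complex" where
  "qfac_inf q = (\<Prod>j. 1 - q ^ Suc j)"

lemma convergent_prod_qfac_inf:
  assumes "norm q < 1"
  shows "convergent_prod (\<lambda>j. 1 - q ^ Suc j :: complex)"
proof -
  have "summable (\<lambda>j. norm (q ^ Suc j))"
    using assms by (subst summable_Suc_iff) (simp add: norm_power)
  hence "abs_convergent_prod (\<lambda>j. 1 + - (q ^ Suc j))"
    by (intro summable_imp_abs_convergent_prod) simp
  thus ?thesis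
    using abs_convergent_prod_imp_convergent_prod by force
qed

(* The tuples (n_1, ..., n_m) of nonnegative integers, as functions that are
   undefined outside {1..m}, so that every tuple is represented exactly once. *)
definition tuples :: "nat \<Rightarrow> (nat \<Rightarrow> nat) set" where
  "tuples m = {1..m} \<rightarrow>\<^sub>E UNIV"

(* The exponent (k+1)n^2 + kn is nonnegative for all integers n. *)
definition lhs_term :: "nat \<Rightarrow> complex \<Rightarrow> int \<Rightarrow> complex" where
  "lhs_term k q n = sg n * q powi ((int k + 1) * n\<^sup>2 + int k * n)"

definition rhs_term :: "nat \<Rightarrow> complex \<Rightarrow> (nat \<Rightarrow> nat) \<Rightarrow> complex" where
  "rhs_term k q n =
     q ^ ((\<Sum>i = 1..2 * k - 2. n i * n (i + 1)) + (\<Sum>i = 1..2 * k - 1. n i))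
       / (\<Prod>i = 1..2 * k - 1. (qfac q (n i))\<^sup>2)"

end

theory Submission
  imports Defs
begin

text \<open>The sum on the right is a walk along a path. With the operator
\[ (Tf)(m) = \sum_{n\ge0} q^{n(m+1)} f(n) / (q)_n^2, \]
called path_step below, summing out the variables one after the other shows that it equals
$(T^{2k-1}1)(0)$ (lemma infsum_path_weight).

Two applications of $T$ are tractable together. If $f(n)/(q)_n^2 = \sum_{j\le n} b_j/(q)_{n-j}$, then a
Cauchy product and Euler's sum $\sum_n q^{n(m+1)}/(q)_n = (q)_m/(q)_\infty$ give
$(Tf)(m) = (q)_m (q)_\infty^{-1} \sum_j q^{j(m+1)} b_j$. The factor $(q)_m$ cancels half of the next
denominator, and Euler's sum applies again:
$(T^2f)(m) = (q)_\infty^{-2} \sum_j q^j b_j (q)_{m+j}$.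
The $q$-Vandermonde identity expands $(q)_{m+j}/(q)_m^2$ in the functions $1/(q)_{m-i}$, so that
$T^2f$ has an expansion of the same kind. Starting from $f = 1$, where
$b_j = q^{j^2}/(q)_j^2$, this yields $b_j = c^{(k)}_j/((q)_j^2 (q)_\infty^{2k})$ for $T^{2k}1$, where
\[ c^{(0)}_i = q^{i^2}, \qquad c^{(k+1)}_i = q^{i^2} \sum_{j\ge i} q^j c^{(k)}_j / (q)_{j-i} \]
(lemma path_sum_expansion). Hence
$(T^{2k+1}1)(0) = (q)_\infty^{-2k-1} \sum_j q^j c^{(k)}_j / (q)_j^2$.

This is a Bailey chain read backwards. By the $a = q$ case of Bailey's lemma,
\[ \sum_i q^i c^{(k)}_i / ((q)_{i-r} (q)_{i+r+1}) = q^{(k+1)(r^2+r)} / (q)_\infty \]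
(lemma bailey_seq_transform), and the Bailey pair
\[ 1/(q)_n^2 = \sum_{r\le n} q^{r^2} (1 - q^{2r+1}) / ((q)_{n-r} (q)_{n+r+1}), \]
whose right-hand side telescopes, turns the remaining sum into
$(q)_\infty^{-1}\sum_{r\ge0} q^{r^2}(1-q^{2r+1}) q^{(k+1)(r^2+r)}$. This is the false theta series for
$k+1$, the two parts of $1-q^{2r+1}$ being its terms with index $r$ and $-r-1$.

All interchanges of summation are justified by domination by a geometric (double) series: the numbers
$(q)_n$ and $1/(q)_n$ are bounded, because $(q)_n$ tends to $(q)_\infty \ne 0$.\<close>

section \<open>Finite and infinite $q$-factorials\<close>

lemma qfac_0 [simp]: "qfac q 0 = 1"
  by (simp add: qfac_def)

lemma qfac_Suc: "qfac q (Suc n) = qfac q n * (1 - q ^ Suc n)"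
  by (simp add: qfac_def)

lemma one_minus_power_nonzero:
  fixes q :: complex
  assumes "norm q < 1"
  shows "1 - q ^ Suc n \<noteq> 0"
proof
  assume "1 - q ^ Suc n = 0"
  hence "norm q ^ Suc n = 1"
    by (metis eq_iff_diff_eq_0 norm_one norm_power)
  moreover have "norm q ^ Suc n < 1"
    using assms power_less_one_iff[of "norm q" "Suc n"] by simp
  ultimately show False by simp
qed

lemma qfac_nonzero:
  assumes "norm q < 1"
  shows "qfac q n \<noteq> 0"
  by (induction n) (use one_minus_power_nonzero[OF assms] in \<open>auto simp: qfac_Suc simp del: power_Suc\<close>)

lemma qfac_inf_nonzero:
  assumes "norm q < 1"
  shows "qfac_inf q \<noteq> 0"
  unfolding qfac_inf_def
  using convergent_prod_qfac_inf[OF assms] one_minus_power_nonzero[OF assms]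
  by (rule prodinf_nonzero)

lemma qfac_tendsto:
  assumes "norm q < 1"
  shows "qfac q \<longlonglongrightarrow> qfac_inf q"
proof -
  have "(\<lambda>n. \<Prod>j\<le>n. 1 - q ^ Suc j) \<longlonglongrightarrow> qfac_inf q"
    unfolding qfac_inf_def
    by (rule convergent_prod_LIMSEQ[OF convergent_prod_qfac_inf[OF assms]])
  moreover have "(\<Prod>j\<le>n. 1 - q ^ Suc j) = qfac q (Suc n)" for n
    by (induction n) (simp_all add: qfac_Suc)
  ultimately show ?thesis
    by (simp add: filterlim_sequentially_Suc)
qed

lemma qfac_inverse_tendsto:
  assumes "norm q < 1"
  shows "(\<lambda>n. 1 / qfac q n) \<longlonglongrightarrow> 1 / qfac_inf q"
  by (intro tendsto_divide tendsto_const qfac_tendsto qfac_inf_nonzero assms)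

lemma qfac_bounds:
  assumes "norm q < 1"
  obtains C where "C \<ge> 1" "\<And>n. norm (qfac q n) \<le> C" "\<And>n. norm (1 / qfac q n) \<le> C"
proof -
  obtain A where A: "\<And>n. norm (qfac q n) \<le> A"
    using convergent_imp_Bseq[OF convergentI[OF qfac_tendsto[OF assms]]] by (auto simp: Bseq_def)
  obtain B where B: "\<And>n. norm (1 / qfac q n) \<le> B"
    using convergent_imp_Bseq[OF convergentI[OF qfac_inverse_tendsto[OF assms]]]
    by (auto simp: Bseq_def)
  show ?thesis
    by (rule that[of "max 1 (max A B)"]) (use A B in \<open>auto simp: le_max_iff_disj\<close>)
qed

section \<open>Gaussian binomial coefficients\<close>

text \<open>The Gaussian binomial coefficient, defined by a $q$-Pascal rule. It vanishes for $k > n$.\<close>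

fun qbinom :: "'a::comm_semiring_1 \<Rightarrow> nat \<Rightarrow> nat \<Rightarrow> 'a" where
  "qbinom q n 0 = 1"
| "qbinom q 0 (Suc k) = 0"
| "qbinom q (Suc n) (Suc k) = qbinom q n k + q ^ Suc k * qbinom q n (Suc k)"

lemma qbinom_eq_0: "n < k \<Longrightarrow> qbinom q n k = 0"
  by (induction q n k rule: qbinom.induct) auto

lemma qbinom_self: "qbinom q n n = 1"
  by (induction n) (simp_all add: qbinom_eq_0)

lemma qbinom_mult_qfac:
  "k \<le> n \<Longrightarrow> qbinom q n k * qfac q k * qfac q (n - k) = qfac q n"
proof (induction q n k rule: qbinom.induct)
  case (3 q n k)
  show ?case
  proof (cases "k = n")
    case True
    thus ?thesis by (simp add: qbinom_self qbinom_eq_0)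
  next
    case False
    with 3 have k: "Suc k \<le> n" by simp
    define d where "d = n - Suc k"
    have n: "n = Suc k + d" and d: "n - k = Suc d" "Suc n - Suc k = Suc d"
      using k by (auto simp: d_def)
    have "qbinom q (Suc n) (Suc k) * qfac q (Suc k) * qfac q (Suc n - Suc k)
        = (qbinom q n k * qfac q k * qfac q (n - k)) * (1 - q ^ Suc k)
          + q ^ Suc k * (qbinom q n (Suc k) * qfac q (Suc k) * qfac q (n - Suc k)) * (1 - q ^ Suc d)"
      by (simp only: d qbinom.simps qfac_Suc[of q d] qfac_Suc[of q k] d_def[symmetric]) algebra
    also have "\<dots> = qfac q n * (1 - q ^ Suc k) + q ^ Suc k * qfac q n * (1 - q ^ Suc d)"
      using 3 k by simp
    also have "\<dots> = qfac q n * (1 - q ^ (Suc k + Suc d))"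
      by (simp only: power_add) algebra
    also have "\<dots> = qfac q (Suc n)"
      by (simp add: qfac_Suc n)
    finally show ?thesis .
  qed
qed auto

lemma qbinom_eq_qfac:
  assumes "norm q < 1" "k \<le> n"
  shows "qbinom q n k = qfac q n / (qfac q k * qfac q (n - k))"
  using qbinom_mult_qfac[OF assms(2), of q] qfac_nonzero[OF assms(1)]
  by (simp add: field_simps)

lemma qbinom_bounded:
  fixes q :: complex
  assumes "norm q < 1"
  obtains C where "\<And>n k. norm (qbinom q n k) \<le> C"
proof -
  obtain C where C: "C \<ge> 1" "\<And>n. norm (qfac q n) \<le> C" "\<And>n. norm (1 / qfac q n) \<le> C"
    using qfac_bounds[OF assms] by blast
  have "norm (qbinom q n k) \<le> C * (C * C)" for n k
  proof (cases "k \<le> n")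
    case True
    have "norm (qbinom q n k) = norm (qfac q n) * (norm (1 / qfac q k) * norm (1 / qfac q (n - k)))"
      using True by (simp add: qbinom_eq_qfac[OF assms] norm_mult norm_divide)
    also have "\<dots> \<le> C * (C * C)"
      using C by (intro mult_mono mult_nonneg_nonneg) auto
    finally show ?thesis .
  next
    case False
    thus ?thesis using C(1) by (simp add: qbinom_eq_0)
  qed
  thus ?thesis using that by blast
qed

text \<open>A common form of the $q$-Vandermonde identity and of its limit: any family that obeys the $q$-Pascal rule
may stand in for the second binomial coefficient. In the induction on $M$, the $q$-Pascal rule for the first
coefficient turns the sum for $(M+1, P, c)$ into the sum for $(M, P+1, c+1)$.\<close>

lemma qbinom_convolution:
  fixes g :: "nat \<Rightarrow> nat \<Rightarrow> 'a::comm_semiring_1"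
  assumes "\<And>P k. g (Suc P) (Suc k) = g P k + q ^ Suc k * g P (Suc k)"
  shows "(\<Sum>l\<le>M. q ^ (l * (l + c)) * qbinom q M l * g P (l + c)) = g (P + M) (M + c)"
proof (induction M arbitrary: P c)
  case 0
  show ?case by simp
next
  case (Suc M)
  define X where "X l = q ^ (l * (l + c) + l) * qbinom q M l * g P (l + c)" for l
  define Y where "Y l = q ^ (Suc l * (Suc l + c)) * qbinom q M l * g P (Suc l + c)" for l
  have "(\<Sum>l\<le>Suc M. q ^ (l * (l + c)) * qbinom q (Suc M) l * g P (l + c))
      = g P c + (\<Sum>l\<le>M. X (Suc l) + Y l)"
    by (subst sum.atMost_Suc_shift)
      (simp add: X_def Y_def algebra_simps power_add)
  also have "\<dots> = (\<Sum>l\<le>Suc M. X l) + (\<Sum>l\<le>M. Y l)"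
    by (subst sum.atMost_Suc_shift) (simp add: sum.distrib X_def add_ac)
  also have "(\<Sum>l\<le>Suc M. X l) = (\<Sum>l\<le>M. X l)"
    by (simp add: X_def qbinom_eq_0)
  also have "(\<Sum>l\<le>M. X l) + (\<Sum>l\<le>M. Y l)
      = (\<Sum>l\<le>M. q ^ (l * (l + Suc c)) * qbinom q M l * g (Suc P) (l + Suc c))"
    unfolding sum.distrib[symmetric]
  proof (rule sum.cong[OF refl])
    fix l
    show "X l + Y l = q ^ (l * (l + Suc c)) * qbinom q M l * g (Suc P) (l + Suc c)"
      using assms[of P "l + c"]
      by (simp add: X_def Y_def algebra_simps power_add)
  qed
  also have "\<dots> = g (Suc P + M) (M + Suc c)"
    by (rule Suc.IH)
  finally show ?case by simp
qed

text \<open>Here $g(P,k) = 1/(q)_k$, the limit of the Gaussian binomial coefficient for $P\to\infty$.\<close>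

lemma qfac_convolution:
  assumes "norm q < 1"
  shows "(\<Sum>l\<le>M. q ^ (l * (l + c)) * qbinom q M l / qfac q (l + c)) = 1 / qfac q (M + c)"
proof -
  have "1 / qfac q (Suc k) = 1 / qfac q k + q ^ Suc k * (1 / qfac q (Suc k))" for k
    using qfac_nonzero[OF assms] one_minus_power_nonzero[OF assms, of k]
    by (simp add: qfac_Suc divide_simps)
  from qbinom_convolution[where g = "\<lambda>_ k. 1 / qfac q k" and q = q and M = M and c = c and P = 0, OF this]
  show ?thesis by simp
qed

lemma qbinom_vandermonde:
  "(\<Sum>i\<le>n. q ^ (i * i) * qbinom q n i * qbinom q j i) = qbinom q (j + n) n"
  using qbinom_convolution[where g = "qbinom q" and q = q and M = n and c = 0 and P = j] by simp

section \<open>Sums dominated by geometric series\<close>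

lemma summable_on_product_nonneg:
  fixes a :: "'a \<Rightarrow> real" and b :: "'b \<Rightarrow> real"
  assumes "a summable_on A" "b summable_on B"
    and "\<And>x. x \<in> A \<Longrightarrow> a x \<ge> 0" "\<And>y. y \<in> B \<Longrightarrow> b y \<ge> 0"
  shows "(\<lambda>(x, y). a x * b y) summable_on A \<times> B"
proof (rule summable_on_SigmaI)
  show "((\<lambda>y. case (x, y) of (x, y) \<Rightarrow> a x * b y) has_sum a x * infsum b B) B" for x
    using has_sum_cmult_right[OF has_sum_infsum[OF assms(2)], of "a x"] by simp
  show "(\<lambda>x. a x * infsum b B) summable_on A"
    by (rule summable_on_cmult_left[OF assms(1)])
qed (use assms in auto)

lemma geometric_summable_on:
  fixes r :: real
  assumes "0 \<le> r" "r < 1"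
  shows "(\<lambda>n. r ^ n) summable_on UNIV"
  using assms by (intro norm_summable_imp_summable_on) simp

lemma geometric_dominated_summable:
  fixes a :: "nat \<Rightarrow> complex" and r :: real
  assumes "0 \<le> r" "r < 1" "\<And>n. norm (a n) \<le> B * r ^ n"
  shows "summable (\<lambda>n. norm (a n))"
proof (rule summable_comparison_test)
  show "summable (\<lambda>n. B * r ^ n)"
    using assms by (intro summable_mult) simp
qed (use assms in auto)

lemma geometric_dominated_summable_on:
  fixes a :: "nat \<Rightarrow> complex" and r :: real
  assumes "0 \<le> r" "r < 1" "\<And>n. norm (a n) \<le> B * r ^ n"
  shows "a summable_on UNIV"
  using geometric_dominated_summable[OF assms] by (rule norm_summable_imp_summable_on)

lemma geometric_dominated_infsum_swap:
  fixes a :: "nat \<Rightarrow> nat \<Rightarrow> complex" and r :: real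
  assumes "0 \<le> r" "r < 1" "\<And>i j. norm (a i j) \<le> B * (r ^ i * r ^ j)"
  shows "(\<Sum>\<^sub>\<infinity>i. \<Sum>\<^sub>\<infinity>j. a i j) = (\<Sum>\<^sub>\<infinity>j. \<Sum>\<^sub>\<infinity>i. a i j)"
proof (rule infsum_swap_banach)
  have "(\<lambda>x. B * (case x of (i, j) \<Rightarrow> r ^ i * r ^ j)) summable_on UNIV \<times> UNIV"
    by (intro summable_on_cmult_right summable_on_product_nonneg geometric_summable_on)
       (use assms in auto)
  hence "(\<lambda>x. norm (case x of (i, j) \<Rightarrow> a i j)) summable_on UNIV \<times> UNIV"
    by (rule Infinite_Sum.abs_summable_on_comparison_test') (use assms(3) in auto)
  thus "(\<lambda>(i, j). a i j) summable_on UNIV \<times> UNIV"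
    by (rule abs_summable_summable)
qed

lemma infsum_finite_sum_swap:
  fixes a :: "nat \<Rightarrow> nat \<Rightarrow> complex"
  assumes "\<And>i. i \<le> n \<Longrightarrow> a i summable_on UNIV"
  shows "(\<Sum>\<^sub>\<infinity>j. \<Sum>i\<le>n. a i j) = (\<Sum>i\<le>n. \<Sum>\<^sub>\<infinity>j. a i j)"
proof (rule infsumI)
  show "((\<lambda>j. \<Sum>i\<le>n. a i j) has_sum (\<Sum>i\<le>n. \<Sum>\<^sub>\<infinity>j. a i j)) UNIV"
    using assms
  proof (induction n)
    case (Suc n)
    have "((\<lambda>j. \<Sum>i\<le>n. a i j) has_sum (\<Sum>i\<le>n. \<Sum>\<^sub>\<infinity>j. a i j)) UNIV"
      using Suc by simp
    thus ?case
      using has_sum_add[OF _ has_sum_infsum[OF Suc.prems[of "Suc n"]]] by simp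
  qed (simp add: has_sum_infsum)
qed

lemma power_weight_bound:
  fixes q :: complex
  assumes "norm q < 1" "norm x \<le> C" "i \<le> m"
  shows "norm (q ^ m * x) \<le> C * norm q ^ i"
proof -
  have "norm q ^ m \<le> norm q ^ i"
    using assms by (intro power_decreasing) auto
  hence "norm q ^ m * norm x \<le> norm q ^ i * C"
    using assms by (intro mult_mono) auto
  thus ?thesis by (simp add: norm_mult norm_power mult.commute)
qed

section \<open>Euler's sum and a limit of the $q$-Vandermonde identity\<close>

text \<open>Euler's identity $\sum_n z^n/(q)_n = 1/(z;q)_\infty$ at $z = q^{m+1}$. For $m = 0$ the partial sums
are $1/(q)_N$; replacing $z$ by $qz$ multiplies the sum by $1-z$.\<close>

lemma euler_exponential_sum:
  assumes q: "norm q < 1"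
  shows "((\<lambda>n. q ^ (n * Suc m) / qfac q n) has_sum (qfac q m / qfac_inf q)) UNIV"
proof -
  obtain C where C: "C \<ge> 1" "\<And>n. norm (qfac q n) \<le> C" "\<And>n. norm (1 / qfac q n) \<le> C"
    using qfac_bounds[OF q] by blast
  have summ: "summable (\<lambda>n. norm (q ^ (n * Suc m) / qfac q n))" for m
  proof (rule geometric_dominated_summable)
    fix n
    show "norm (q ^ (n * Suc m) / qfac q n) \<le> C * norm q ^ n"
      using power_weight_bound[OF q C(3)[of n], of n "n * Suc m"] by simp
  qed (use q in auto)
  have "(\<lambda>n. q ^ (n * Suc m) / qfac q n) sums (qfac q m / qfac_inf q)"
  proof (induction m)
    case 0
    \<comment> \<open>The partial sums telescope: $q^n/(q)_n = 1/(q)_n - 1/(q)_{n-1}$.\<close>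
    have "(\<Sum>n\<le>N. q ^ n / qfac q n) = 1 / qfac q N" for N
    proof (induction N)
      case (Suc N)
      have "(\<Sum>n\<le>Suc N. q ^ n / qfac q n) = 1 / qfac q N + q ^ Suc N / qfac q (Suc N)"
        by (simp only: sum.atMost_Suc Suc.IH)
      also have "\<dots> = 1 / qfac q (Suc N)"
        using qfac_nonzero[OF q] one_minus_power_nonzero[OF q, of N]
        by (simp add: qfac_Suc divide_simps)
      finally show ?case .
    qed simp
    thus ?case
      using qfac_inverse_tendsto[OF q] by (simp add: sums_def_le)
  next
    case (Suc m)
    have "(\<lambda>n. q ^ Suc m * (q ^ (n * Suc m) / qfac q n)) sums (q ^ Suc m * (qfac q m / qfac_inf q))"
      by (rule sums_mult[OF Suc.IH])
    also have "(\<lambda>n. q ^ Suc m * (q ^ (n * Suc m) / qfac q n))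
             = (\<lambda>n. q ^ (Suc n * Suc m) / qfac q (Suc n) * (1 - q ^ Suc n))"
    proof (rule ext)
      fix n
      have "q ^ (Suc n * Suc m) = q ^ Suc m * q ^ (n * Suc m)"
        by (simp only: power_add[symmetric] mult_Suc)
      thus "q ^ Suc m * (q ^ (n * Suc m) / qfac q n)
          = q ^ (Suc n * Suc m) / qfac q (Suc n) * (1 - q ^ Suc n)"
        using one_minus_power_nonzero[OF q, of n]
        by (simp add: qfac_Suc del: power_Suc mult_Suc mult_Suc_right)
    qed
    \<comment> \<open>After the shift of the index the term with $n = 0$ vanishes.\<close>
    finally have "(\<lambda>n. q ^ (n * Suc m) / qfac q n * (1 - q ^ n)) sums (q ^ Suc m * (qfac q m / qfac_inf q))"
      by (subst (asm) sums_Suc_iff) simp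
    from sums_diff[OF Suc.IH this]
    have "(\<lambda>n. q ^ (n * Suc m) / qfac q n - q ^ (n * Suc m) / qfac q n * (1 - q ^ n)) sums
            (qfac q m / qfac_inf q - q ^ Suc m * (qfac q m / qfac_inf q))" .
    also have "(\<lambda>n. q ^ (n * Suc m) / qfac q n - q ^ (n * Suc m) / qfac q n * (1 - q ^ n))
             = (\<lambda>n. q ^ (n * Suc (Suc m)) / qfac q n)"
      by (intro ext) (simp add: right_diff_distrib power_add)
    finally have "(\<lambda>n. q ^ (n * Suc (Suc m)) / qfac q n) sums
            (qfac q m / qfac_inf q - q ^ Suc m * (qfac q m / qfac_inf q))" .
    thus ?case
      by (simp add: qfac_Suc algebra_simps diff_divide_distrib)
  qed
  thus ?thesis
    using summ[of m] by (intro norm_summable_imp_has_sum)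
qed

text \<open>The limit $M\to\infty$ of qfac_convolution, by dominated convergence for series. For $c = 0$ this is Durfee's
identity for the generating function of partitions.\<close>

lemma qfac_convolution_limit:
  assumes q: "norm q < 1"
  shows "((\<lambda>l. q ^ (l * (l + c)) / (qfac q l * qfac q (l + c))) has_sum (1 / qfac_inf q)) UNIV"
proof -
  obtain C where C: "C \<ge> 1" "\<And>n. norm (qfac q n) \<le> C" "\<And>n. norm (1 / qfac q n) \<le> C"
    using qfac_bounds[OF q] by blast
  obtain D where D: "\<And>n k. norm (qbinom q n k) \<le> D"
    using qbinom_bounded[OF q] by blast
  define a where "a l M = q ^ (l * (l + c)) * qbinom q M l / qfac q (l + c)" for l M
  define b where "b l = q ^ (l * (l + c)) / (qfac q l * qfac q (l + c))" for l
  have lim: "(\<lambda>M. a l M) \<longlonglongrightarrow> b l" for l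
  proof -
    have "(\<lambda>M. qfac q M / (qfac q l * qfac q (M - l))) \<longlonglongrightarrow> qfac_inf q / (qfac q l * qfac_inf q)"
    proof (intro tendsto_intros qfac_tendsto q)
      show "(\<lambda>M. qfac q (M - l)) \<longlonglongrightarrow> qfac_inf q"
        by (rule filterlim_compose[OF qfac_tendsto[OF q] filterlim_minus_const_nat_at_top])
    qed (use qfac_nonzero[OF q] qfac_inf_nonzero[OF q] in auto)
    moreover have "eventually (\<lambda>M. qfac q M / (qfac q l * qfac q (M - l)) = qbinom q M l) sequentially"
      using eventually_ge_at_top[of l] by eventually_elim (simp add: qbinom_eq_qfac[OF q])
    ultimately have "(\<lambda>M. qbinom q M l) \<longlonglongrightarrow> qfac_inf q / (qfac q l * qfac_inf q)"
      by (rule Lim_transform_eventually)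
    hence "(\<lambda>M. a l M) \<longlonglongrightarrow>
        q ^ (l * (l + c)) * (qfac_inf q / (qfac q l * qfac_inf q)) / qfac q (l + c)"
      unfolding a_def using qfac_nonzero[OF q] by (intro tendsto_intros)
    thus ?thesis
      using qfac_inf_nonzero[OF q] by (simp add: b_def)
  qed
  have bound: "norm (a l M) \<le> (D * C) * norm q ^ l" for l M
  proof -
    have "norm (qbinom q M l * (1 / qfac q (l + c))) \<le> D * C"
      unfolding norm_mult by (intro mult_mono C D order.trans[OF norm_ge_zero D]) auto
    from power_weight_bound[OF q this, of l "l * (l + c)"] show ?thesis
      by (simp add: a_def)
  qed
  have summ: "summable (\<lambda>l. (D * C) * norm q ^ l)"
    using q by (intro summable_mult) simp
  have ev: "eventually (\<lambda>(l, M). norm (a l M) \<le> (D * C) * norm q ^ l) (sequentially \<times>\<^sub>F sequentially)"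
    by (rule always_eventually) (use bound in auto)
  have T: "summable (\<lambda>l. norm (b l)) \<and> (\<lambda>M. suminf (\<lambda>l. a l M)) \<longlonglongrightarrow> suminf b"
    using tannerys_theorem[where a = a and b = b and F = sequentially, OF lim ev summ] by simp
  have "suminf (\<lambda>l. a l M) = 1 / qfac q (M + c)" for M
  proof -
    have "suminf (\<lambda>l. a l M) = (\<Sum>l\<le>M. a l M)"
      by (rule suminf_finite) (auto simp: a_def qbinom_eq_0)
    thus ?thesis using qfac_convolution[OF q] by (simp add: a_def)
  qed
  with T have "(\<lambda>M. 1 / qfac q (M + c)) \<longlonglongrightarrow> suminf b" by simp
  moreover have "(\<lambda>M. 1 / qfac q (M + c)) \<longlonglongrightarrow> 1 / qfac_inf q"
    by (rule LIMSEQ_ignore_initial_segment[OF qfac_inverse_tendsto[OF q]])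
  ultimately have "suminf b = 1 / qfac_inf q"
    by (rule LIMSEQ_unique)
  with T have "b sums (1 / qfac_inf q)"
    by (metis summable_norm_cancel summable_sums)
  with T have "(b has_sum (1 / qfac_inf q)) UNIV"
    by (intro norm_summable_imp_has_sum) auto
  thus ?thesis unfolding b_def .
qed

text \<open>A Bailey pair relative to $a = q$, up to the factor $1-q$. The sum telescopes because
$1 - q^{2r+1} = (1-q^{n+r+1}) - q^{2r+1}(1-q^{n-r})$.\<close>

lemma inverse_qfac_square_bailey:
  assumes q: "norm q < 1"
  shows "(\<Sum>r\<le>n. q ^ r\<^sup>2 * (1 - q ^ (2 * r + 1)) / (qfac q (n - r) * qfac q (n + r + 1)))
           = 1 / (qfac q n)\<^sup>2"
proof -
  define X where "X r = (if r \<le> n then q ^ r\<^sup>2 / (qfac q (n - r) * qfac q (n + r)) else 0)" for r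
  have "q ^ r\<^sup>2 * (1 - q ^ (2 * r + 1)) / (qfac q (n - r) * qfac q (n + r + 1)) = X r - X (Suc r)"
    if "r \<le> n" for r
  proof (cases "r = n")
    case True
    have "2 * n + 1 = Suc (n + n)" by simp
    thus ?thesis
      using one_minus_power_nonzero[OF q, of "n + n"]
      unfolding True by (simp add: X_def qfac_Suc mult_2 del: power_Suc)
  next
    case False
    define d where "d = n - Suc r"
    have d: "n - r = Suc d" "n = Suc (r + d)" using that False by (auto simp: d_def)
    have *: "X r = q ^ r\<^sup>2 * (1 - q ^ Suc (n + r)) / (qfac q (n - r) * qfac q (n + r + 1))"
      using one_minus_power_nonzero[OF q, of "n + r"] that
      by (simp add: X_def qfac_Suc del: power_Suc)
    have "X (Suc r) = q ^ (Suc r)\<^sup>2 / (qfac q d * qfac q (n + r + 1))"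
      using that False by (simp add: X_def d_def)
    also have "\<dots> = q ^ (Suc r)\<^sup>2 * (1 - q ^ Suc d) / (qfac q (n - r) * qfac q (n + r + 1))"
      using one_minus_power_nonzero[OF q, of d] by (simp add: d(1) qfac_Suc del: power_Suc)
    finally have "X r - X (Suc r)
        = (q ^ r\<^sup>2 * (1 - q ^ Suc (n + r)) - q ^ (Suc r)\<^sup>2 * (1 - q ^ Suc d))
            / (qfac q (n - r) * qfac q (n + r + 1))"
      unfolding * by (simp add: diff_divide_distrib)
    also have "q ^ r\<^sup>2 * (1 - q ^ Suc (n + r)) - q ^ (Suc r)\<^sup>2 * (1 - q ^ Suc d)
             = q ^ r\<^sup>2 * (1 - q ^ (2 * r + 1))"
      by (simp add: d(2) power2_eq_square power_add algebra_simps mult_2_right)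
    finally show ?thesis ..
  qed
  hence "(\<Sum>r\<le>n. q ^ r\<^sup>2 * (1 - q ^ (2 * r + 1)) / (qfac q (n - r) * qfac q (n + r + 1)))
      = (\<Sum>r\<le>n. X r - X (Suc r))"
    by (intro sum.cong) auto
  also have "\<dots> = X 0 - X (Suc n)"
    by (rule sum_telescope)
  also have "\<dots> = 1 / (qfac q n)\<^sup>2"
    by (simp add: X_def power2_eq_square)
  finally show ?thesis .
qed

section \<open>The path operator and the Bailey sequences\<close>

text \<open>The number $1/(q)_{n-k}$ with the usual convention that it is $0$ for $k > n$; this lets triangular sums
run over all indices.\<close>

definition inv_qfac_diff :: "complex \<Rightarrow> nat \<Rightarrow> nat \<Rightarrow> complex" where
  "inv_qfac_diff q n k = (if k \<le> n then 1 / qfac q (n - k) else 0)"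

text \<open>Summation over one vertex of the path, whose neighbour on one side carries $m$, while $f$ collects
everything on the other side. The factor $q^n$ of the vertex itself is included.\<close>

definition path_step :: "complex \<Rightarrow> (nat \<Rightarrow> complex) \<Rightarrow> nat \<Rightarrow> complex" where
  "path_step q f m = (\<Sum>\<^sub>\<infinity>n. q ^ (n * Suc m) * (f n / (qfac q n)\<^sup>2))"

text \<open>The numbers $c^{(k)}_i$ of the introduction: the coefficients of $T^{2k}1$, up to normalisation.\<close>

fun bailey_seq :: "complex \<Rightarrow> nat \<Rightarrow> nat \<Rightarrow> complex" where
  "bailey_seq q 0 i = q ^ i\<^sup>2"
| "bailey_seq q (Suc k) i = q ^ i\<^sup>2 * (\<Sum>\<^sub>\<infinity>j. q ^ j * (bailey_seq q k j * inv_qfac_diff q j i))"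

lemma inv_qfac_diff_bound:
  assumes "\<And>n. norm (1 / qfac q n) \<le> C"
  shows "norm (inv_qfac_diff q n k) \<le> C"
  using assms[of "n - k"] order.trans[OF norm_ge_zero assms[of 0]] by (auto simp: inv_qfac_diff_def)

lemma bailey_seq_bounded:
  assumes q: "norm q < 1"
  shows "\<exists>B. \<forall>i. norm (bailey_seq q k i) \<le> B"
proof (induction k)
  case 0
  have "norm (bailey_seq q 0 i) \<le> 1" for i
    using q by (simp add: norm_power power_le_one)
  thus ?case by blast
next
  case (Suc k)
  obtain C where C: "C \<ge> 1" "\<And>n. norm (qfac q n) \<le> C" "\<And>n. norm (1 / qfac q n) \<le> C"
    using qfac_bounds[OF q] by blast
  obtain B where B: "\<And>i. norm (bailey_seq q k i) \<le> B"
    using Suc by blast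
  define K where "K = (\<Sum>\<^sub>\<infinity>j. (B * C) * norm q ^ j)"
  have "norm (bailey_seq q (Suc k) i) \<le> K" for i
  proof -
    have bound: "norm (q ^ j * (bailey_seq q k j * inv_qfac_diff q j i)) \<le> (B * C) * norm q ^ j" for j
    proof (rule power_weight_bound[OF q])
      show "norm (bailey_seq q k j * inv_qfac_diff q j i) \<le> B * C"
        unfolding norm_mult using B inv_qfac_diff_bound[OF C(3)]
        by (intro mult_mono order.trans[OF norm_ge_zero B]) auto
    qed simp
    have "norm (\<Sum>\<^sub>\<infinity>j. q ^ j * (bailey_seq q k j * inv_qfac_diff q j i)) \<le> K"
      unfolding K_def
    proof (rule norm_infsum_le)
      show "((\<lambda>j. q ^ j * (bailey_seq q k j * inv_qfac_diff q j i)) has_sum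
        (\<Sum>\<^sub>\<infinity>j. q ^ j * (bailey_seq q k j * inv_qfac_diff q j i))) UNIV"
        by (rule has_sum_infsum, rule geometric_dominated_summable_on[OF _ q bound]) simp
      show "((\<lambda>j. (B * C) * norm q ^ j) has_sum (\<Sum>\<^sub>\<infinity>j. (B * C) * norm q ^ j)) UNIV"
        using q by (intro has_sum_infsum summable_on_cmult_right geometric_summable_on) auto
    qed (use bound in auto)
    from power_weight_bound[OF q this, of 0 "i\<^sup>2"] show ?thesis by simp
  qed
  thus ?case by blast
qed

text \<open>The multiplier $q^{n(m+1)}$ splits along $n = j + (n-j)$, so the double sum is a Cauchy product, the second
factor of which is Euler's sum.\<close>

lemma path_step_expansion:
  assumes q: "norm q < 1"
    and f: "\<And>n. f n / (qfac q n)\<^sup>2 = (\<Sum>j\<le>n. b j / qfac q (n - j))"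
    and b: "\<And>j. norm (b j) \<le> B"
  shows "path_step q f m = qfac q m / qfac_inf q * (\<Sum>\<^sub>\<infinity>j. q ^ (j * Suc m) * b j)"
proof -
  obtain C where C: "C \<ge> 1" "\<And>n. norm (qfac q n) \<le> C" "\<And>n. norm (1 / qfac q n) \<le> C"
    using qfac_bounds[OF q] by blast
  define u where "u j = q ^ (j * Suc m) * b j" for j
  define v where "v n = q ^ (n * Suc m) / qfac q n" for n
  have u: "summable (\<lambda>j. norm (u j))"
    unfolding u_def
    by (rule geometric_dominated_summable[OF _ q]) (auto intro!: power_weight_bound[OF q b])
  have "norm (v n) \<le> C * norm q ^ n" for n
    using power_weight_bound[OF q C(3)[of n], of n "n * Suc m"] by (simp add: v_def)
  hence v: "summable (\<lambda>n. norm (v n))"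
    by (intro geometric_dominated_summable[OF _ q]) auto
  have "summable (\<lambda>n. \<Sum>i\<le>n. norm (u i) * norm (v (n - i)))"
    using Cauchy_product_sums[of "\<lambda>i. norm (u i)" "\<lambda>i. norm (v i)"] u v
    by (simp add: sums_iff)
  hence conv: "summable (\<lambda>n. norm (\<Sum>i\<le>n. u i * v (n - i)))"
    by (rule summable_comparison_test[rotated])
       (auto simp: norm_mult intro!: exI[of _ 0] order.trans[OF norm_sum] sum_mono)
  have "q ^ (n * Suc m) * (f n / (qfac q n)\<^sup>2) = (\<Sum>i\<le>n. u i * v (n - i))" for n
    unfolding f sum_distrib_left
  proof (rule sum.cong[OF refl])
    fix j assume "j \<in> {..n}"
    hence "n * Suc m = j * Suc m + (n - j) * Suc m"
      by (metis add_mult_distrib atMost_iff le_add_diff_inverse)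
    thus "q ^ (n * Suc m) * (b j / qfac q (n - j)) = u j * v (n - j)"
      unfolding u_def v_def by (simp only: power_add) simp
  qed
  hence "path_step q f m = (\<Sum>\<^sub>\<infinity>n. \<Sum>i\<le>n. u i * v (n - i))"
    by (simp add: path_step_def)
  also have "\<dots> = suminf u * suminf v"
    by (rule infsumI, rule norm_summable_imp_has_sum[OF conv Cauchy_product_sums[OF u v]])
  also have "suminf u = infsum u UNIV"
    by (rule infsumI[symmetric], rule norm_summable_imp_has_sum[OF u])
       (use u in \<open>simp add: summable_norm_cancel summable_sums\<close>)
  also have "suminf v = qfac q m / qfac_inf q"
    unfolding v_def[abs_def]
    by (rule sums_unique[symmetric], rule has_sum_imp_sums[OF euler_exponential_sum[OF q]])
  finally show ?thesis by (simp add: u_def)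
qed

lemma path_step_twice_expansion:
  assumes q: "norm q < 1"
    and f: "\<And>n. f n / (qfac q n)\<^sup>2 = (\<Sum>j\<le>n. b j / qfac q (n - j))"
    and b: "\<And>j. norm (b j) \<le> B"
  shows "path_step q (path_step q f) m = (\<Sum>\<^sub>\<infinity>j. q ^ j * b j * qfac q (m + j)) / (qfac_inf q)\<^sup>2"
proof -
  obtain C where C: "C \<ge> 1" "\<And>n. norm (qfac q n) \<le> C" "\<And>n. norm (1 / qfac q n) \<le> C"
    using qfac_bounds[OF q] by blast
  define a where "a n j = q ^ j * b j * (q ^ (n * Suc (m + j)) / qfac q n)" for n j
  have bound: "norm (a n j) \<le> (B * C) * (norm q ^ n * norm q ^ j)" for n j
  proof -
    have "norm (q ^ (n * Suc (m + j)) / qfac q n) \<le> C * norm q ^ n"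
      using power_weight_bound[OF q C(3)[of n], of n "n * Suc (m + j)"] by simp
    moreover have "norm (q ^ j * b j) \<le> B * norm q ^ j"
      by (rule power_weight_bound[OF q b]) simp
    ultimately have "norm (a n j) \<le> (B * norm q ^ j) * (C * norm q ^ n)"
      unfolding a_def norm_mult[of "q ^ j * b j"]
      using order.trans[OF norm_ge_zero b] by (intro mult_mono) auto
    thus ?thesis by (simp add: mult_ac)
  qed
  have "q ^ (n * Suc m) * (path_step q f n / (qfac q n)\<^sup>2) = (\<Sum>\<^sub>\<infinity>j. a n j) * (1 / qfac_inf q)" for n
  proof -
    have "q ^ (n * Suc m) * (q ^ (j * Suc n) * b j) / qfac q n = a n j" for j
    proof -
      have "n * Suc m + j * Suc n = j + n * Suc (m + j)" by (simp add: algebra_simps)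
      hence "q ^ (n * Suc m) * q ^ (j * Suc n) = q ^ j * q ^ (n * Suc (m + j))"
        by (simp only: power_add[symmetric])
      thus ?thesis unfolding a_def by (simp only: mult.assoc[symmetric]) simp
    qed
    hence "(\<Sum>\<^sub>\<infinity>j. a n j) = (\<Sum>\<^sub>\<infinity>j. q ^ (n * Suc m) / qfac q n * (q ^ (j * Suc n) * b j))"
      by (intro infsum_cong) (simp add: mult_ac)
    also have "\<dots> = q ^ (n * Suc m) / qfac q n * (\<Sum>\<^sub>\<infinity>j. q ^ (j * Suc n) * b j)"
      by (rule infsum_cmult_right')
    finally show ?thesis
      using qfac_nonzero[OF q, of n]
      by (simp add: path_step_expansion[OF q f b] power2_eq_square del: mult_Suc_right)
  qed
  hence "path_step q (path_step q f) m = (\<Sum>\<^sub>\<infinity>n. (\<Sum>\<^sub>\<infinity>j. a n j) * (1 / qfac_inf q))"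
    unfolding path_step_def[of q "path_step q f"] by simp
  also have "\<dots> = (\<Sum>\<^sub>\<infinity>n. \<Sum>\<^sub>\<infinity>j. a n j) * (1 / qfac_inf q)"
    by (rule infsum_cmult_left')
  also have "(\<Sum>\<^sub>\<infinity>n. \<Sum>\<^sub>\<infinity>j. a n j) = (\<Sum>\<^sub>\<infinity>j. \<Sum>\<^sub>\<infinity>n. a n j)"
    by (rule geometric_dominated_infsum_swap[OF _ q bound]) simp
  also have "\<dots> = (\<Sum>\<^sub>\<infinity>j. q ^ j * b j * qfac q (m + j) * (1 / qfac_inf q))"
    unfolding a_def infsum_cmult_right' infsumI[OF euler_exponential_sum[OF q]] by simp
  also have "\<dots> = (\<Sum>\<^sub>\<infinity>j. q ^ j * b j * qfac q (m + j)) * (1 / qfac_inf q)"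
    by (rule infsum_cmult_left')
  finally show ?thesis by (simp add: power2_eq_square)
qed

text \<open>The $q$-Vandermonde identity, in the form that makes the expansions needed for path_step_expansion
reproduce themselves.\<close>

lemma qfac_add_expansion:
  assumes q: "norm q < 1"
  shows "qfac q (n + j) / (qfac q n)\<^sup>2
    = (\<Sum>i\<le>n. q ^ i\<^sup>2 / (qfac q i)\<^sup>2 / qfac q (n - i) * ((qfac q j)\<^sup>2 * inv_qfac_diff q j i))"
proof -
  have nz: "qfac q m \<noteq> 0" for m by (rule qfac_nonzero[OF q])
  have "qfac q (n + j) = qbinom q (j + n) n * qfac q n * qfac q j"
    using qbinom_mult_qfac[of n "j + n" q] by (simp add: add.commute)
  also have "qbinom q (j + n) n = (\<Sum>i\<le>n. q ^ (i * i) * qbinom q n i * qbinom q j i)"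
    by (rule qbinom_vandermonde[symmetric])
  finally have "qfac q (n + j) / (qfac q n)\<^sup>2
      = (\<Sum>i\<le>n. q ^ (i * i) * qbinom q n i * qbinom q j i) * (qfac q j / qfac q n)"
    using nz[of n] by (simp add: power2_eq_square)
  also have "\<dots> = (\<Sum>i\<le>n. q ^ (i * i) * qbinom q n i * qbinom q j i * (qfac q j / qfac q n))"
    by (rule sum_distrib_right)
  also have "\<dots> = (\<Sum>i\<le>n. q ^ i\<^sup>2 / (qfac q i)\<^sup>2 / qfac q (n - i) * ((qfac q j)\<^sup>2 * inv_qfac_diff q j i))"
  proof (rule sum.cong[OF refl])
    fix i assume "i \<in> {..n}"
    hence "qbinom q n i = qfac q n / (qfac q i * qfac q (n - i))"
      by (simp add: qbinom_eq_qfac[OF q])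
    moreover have "qbinom q j i = qfac q j / qfac q i * inv_qfac_diff q j i"
      by (cases "i \<le> j") (simp_all add: qbinom_eq_qfac[OF q] qbinom_eq_0 inv_qfac_diff_def)
    ultimately show "q ^ (i * i) * qbinom q n i * qbinom q j i * (qfac q j / qfac q n)
        = q ^ i\<^sup>2 / (qfac q i)\<^sup>2 / qfac q (n - i) * ((qfac q j)\<^sup>2 * inv_qfac_diff q j i)"
      using nz[of n] by (simp add: power2_eq_square mult_ac)
  qed
  finally show ?thesis .
qed

lemma bailey_seq_div_bounded:
  assumes q: "norm q < 1"
  shows "\<exists>B. \<forall>j. norm (bailey_seq q k j / (qfac q j)\<^sup>2 / c) \<le> B"
proof -
  obtain C where C: "C \<ge> 1" "\<And>n. norm (qfac q n) \<le> C" "\<And>n. norm (1 / qfac q n) \<le> C"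
    using qfac_bounds[OF q] by blast
  obtain B where B: "\<And>i. norm (bailey_seq q k i) \<le> B"
    using bailey_seq_bounded[OF q] by blast
  have "norm (bailey_seq q k j / (qfac q j)\<^sup>2 / c) \<le> B * (C * C) * norm (1 / c)" for j
  proof -
    have "norm (bailey_seq q k j / (qfac q j)\<^sup>2 / c)
        = norm (bailey_seq q k j) * (norm (1 / qfac q j) * norm (1 / qfac q j)) * norm (1 / c)"
      by (simp add: norm_mult norm_divide power2_eq_square)
    also have "\<dots> \<le> B * (C * C) * norm (1 / c)"
      using B C order.trans[OF norm_ge_zero B] by (intro mult_mono mult_nonneg_nonneg) auto
    finally show ?thesis .
  qed
  thus ?thesis by blast
qed

text \<open>The base case $k = 0$ is the Durfee square expansion of $1/(q)_n^2$.\<close>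

lemma path_sum_expansion:
  assumes q: "norm q < 1"
  shows "(path_step q ^^ (2 * k)) (\<lambda>_. 1) n / (qfac q n)\<^sup>2
    = (\<Sum>i\<le>n. bailey_seq q k i / (qfac q i)\<^sup>2 / qfac_inf q ^ (2 * k) / qfac q (n - i))"
proof (induction k arbitrary: n)
  case 0
  have "1 / qfac q n = (\<Sum>i\<le>n. q ^ (i * i) * qbinom q n i / qfac q i)"
    using qfac_convolution[OF q, where M = n and c = 0] by simp
  hence "1 / (qfac q n)\<^sup>2 = (\<Sum>i\<le>n. q ^ (i * i) * qbinom q n i / qfac q i) / qfac q n"
    by (simp add: power2_eq_square flip: divide_divide_eq_left)
  also have "\<dots> = (\<Sum>i\<le>n. q ^ (i * i) * qbinom q n i / qfac q i / qfac q n)"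
    by (rule sum_divide_distrib)
  also have "\<dots> = (\<Sum>i\<le>n. q ^ i\<^sup>2 / (qfac q i)\<^sup>2 / qfac q (n - i))"
    using qfac_nonzero[OF q]
    by (intro sum.cong) (simp_all add: qbinom_eq_qfac[OF q] power2_eq_square)
  finally show ?case by simp
next
  case (Suc k)
  obtain C where C: "C \<ge> 1" "\<And>n. norm (qfac q n) \<le> C" "\<And>n. norm (1 / qfac q n) \<le> C"
    using qfac_bounds[OF q] by blast
  obtain K where K: "\<And>i. norm (bailey_seq q k i) \<le> K"
    using bailey_seq_bounded[OF q] by blast
  define P where "P = qfac_inf q ^ (2 * k)"
  define w where "w i = 1 / (qfac q i)\<^sup>2 / qfac q (n - i) / P * q ^ i\<^sup>2" for i
  obtain B where B: "\<And>j. norm (bailey_seq q k j / (qfac q j)\<^sup>2 / P) \<le> B"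
    using bailey_seq_div_bounded[OF q] by blast
  have summ: "(\<lambda>j. w i * (q ^ j * (bailey_seq q k j * inv_qfac_diff q j i))) summable_on UNIV" for i
  proof (intro summable_on_cmult_right geometric_dominated_summable_on[OF _ q])
    show "norm (q ^ j * (bailey_seq q k j * inv_qfac_diff q j i)) \<le> (K * C) * norm q ^ j" for j
    proof (rule power_weight_bound[OF q])
      show "norm (bailey_seq q k j * inv_qfac_diff q j i) \<le> K * C"
        unfolding norm_mult using K inv_qfac_diff_bound[OF C(3)]
        by (intro mult_mono order.trans[OF norm_ge_zero K]) auto
    qed simp
  qed simp
  have "(path_step q ^^ (2 * Suc k)) (\<lambda>_. 1) n / (qfac q n)\<^sup>2
      = (\<Sum>\<^sub>\<infinity>j. q ^ j * (bailey_seq q k j / (qfac q j)\<^sup>2 / P) * qfac q (n + j))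
          * (1 / (qfac q n)\<^sup>2 * (1 / (qfac_inf q)\<^sup>2))"
    using path_step_twice_expansion[OF q Suc.IH[folded P_def] B, of n] by simp
  also have "\<dots> = (\<Sum>\<^sub>\<infinity>j. q ^ j * (bailey_seq q k j / (qfac q j)\<^sup>2 / P) * (qfac q (n + j) / (qfac q n)\<^sup>2))
          * (1 / (qfac_inf q)\<^sup>2)"
    unfolding mult.assoc[symmetric] infsum_cmult_left'[symmetric] by simp
  also have "(\<Sum>\<^sub>\<infinity>j. q ^ j * (bailey_seq q k j / (qfac q j)\<^sup>2 / P) * (qfac q (n + j) / (qfac q n)\<^sup>2))
      = (\<Sum>\<^sub>\<infinity>j. \<Sum>i\<le>n. w i * (q ^ j * (bailey_seq q k j * inv_qfac_diff q j i)))"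
    unfolding qfac_add_expansion[OF q] sum_distrib_left
    using qfac_nonzero[OF q] by (intro infsum_cong sum.cong) (simp_all add: w_def mult_ac)
  also have "\<dots> = (\<Sum>i\<le>n. \<Sum>\<^sub>\<infinity>j. w i * (q ^ j * (bailey_seq q k j * inv_qfac_diff q j i)))"
    by (rule infsum_finite_sum_swap) (rule summ)
  also have "\<dots> = (\<Sum>i\<le>n. bailey_seq q (Suc k) i / (qfac q i)\<^sup>2 / P / qfac q (n - i))"
    unfolding infsum_cmult_right' by (intro sum.cong) (simp_all add: w_def)
  also have "\<dots> * (1 / (qfac_inf q)\<^sup>2)
      = (\<Sum>i\<le>n. bailey_seq q (Suc k) i / (qfac q i)\<^sup>2 / qfac_inf q ^ (2 * Suc k) / qfac q (n - i))"
    unfolding sum_distrib_right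
    by (intro sum.cong) (simp_all add: P_def power2_eq_square del: bailey_seq.simps)
  finally show ?case .
qed

section \<open>Bailey's lemma\<close>

lemma has_sum_nat_shift:
  fixes f :: "nat \<Rightarrow> complex"
  assumes "((\<lambda>l. f (l + r)) has_sum S) UNIV" and "\<And>i. i < r \<Longrightarrow> f i = 0"
  shows "(f has_sum S) UNIV"
proof -
  have "(f has_sum S) (range (\<lambda>l. l + r))"
    using assms(1) by (subst has_sum_reindex) (auto simp: o_def)
  moreover have "f i = 0" if "i \<notin> range (\<lambda>l. l + r)" for i
    using that assms(2)[of i] by (metis le_add_diff_inverse2 not_less rangeI)
  ultimately show ?thesis
    by (subst has_sum_cong_neutral[where T = "range (\<lambda>l. l + r)" and g = f]) auto
qed

lemma bailey_kernel_limit: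
  assumes q: "norm q < 1"
  shows "((\<lambda>i. q ^ (i\<^sup>2 + i) * inv_qfac_diff q i r / qfac q (i + r + 1)) has_sum
            (q ^ (r\<^sup>2 + r) / qfac_inf q)) UNIV"
proof (rule has_sum_nat_shift[where r = r])
  have "q ^ ((l + r)\<^sup>2 + (l + r)) * inv_qfac_diff q (l + r) r / qfac q (l + r + r + 1)
      = q ^ (r\<^sup>2 + r) * (q ^ (l * (l + (2 * r + 1))) / (qfac q l * qfac q (l + (2 * r + 1))))" for l
  proof -
    have "(l + r)\<^sup>2 + (l + r) = (r\<^sup>2 + r) + l * (l + (2 * r + 1))"
      by (simp add: power2_eq_square algebra_simps)
    moreover have "l + r + r + 1 = l + (2 * r + 1)" by simp
    ultimately show ?thesis
      by (simp only: power_add) (simp add: inv_qfac_diff_def)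
  qed
  thus "((\<lambda>l. q ^ ((l + r)\<^sup>2 + (l + r)) * inv_qfac_diff q (l + r) r / qfac q (l + r + r + 1))
          has_sum (q ^ (r\<^sup>2 + r) / qfac_inf q)) UNIV"
    using has_sum_cmult_right[OF qfac_convolution_limit[OF q, of "2 * r + 1"], of "q ^ (r\<^sup>2 + r)"]
    by simp
qed (simp add: inv_qfac_diff_def)

text \<open>The $a = q$ case of Bailey's lemma in its simplest limiting form: the kernel $1/((q)_{i-r}(q)_{i+r+1})$ is
an eigenfunction, with eigenvalue $q^{r^2+r}$, of the transformation with the matrix
$q^{i^2+i}/(q)_{j-i}$. With $i = l + r$ it is qfac_convolution at $c = 2r+1$. The preceding lemma is the case $j\to\infty$.\<close>

lemma bailey_kernel_reproduces:
  assumes q: "norm q < 1"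
  shows "((\<lambda>i. q ^ (i\<^sup>2 + i) * inv_qfac_diff q j i * inv_qfac_diff q i r / qfac q (i + r + 1)) has_sum
            (q ^ (r\<^sup>2 + r) * (inv_qfac_diff q j r / qfac q (j + r + 1)))) UNIV"
proof (cases "r \<le> j")
  case False
  have "inv_qfac_diff q j i = 0 \<or> inv_qfac_diff q i r = 0" for i
    using False by (auto simp: inv_qfac_diff_def)
  hence "q ^ (i\<^sup>2 + i) * inv_qfac_diff q j i * inv_qfac_diff q i r / qfac q (i + r + 1) = 0" for i
    by auto
  thus ?thesis using False by (simp only: inv_qfac_diff_def) simp
next
  case True
  define M where "M = j - r"
  have j: "j = M + r" using True by (simp add: M_def)
  define f where "f i = q ^ (i\<^sup>2 + i) * inv_qfac_diff q j i * inv_qfac_diff q i r / qfac q (i + r + 1)" for i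
  have f: "f (l + r) = q ^ (r\<^sup>2 + r) / qfac q M *
             (q ^ (l * (l + (2 * r + 1))) * qbinom q M l / qfac q (l + (2 * r + 1)))" for l
  proof -
    have "(l + r)\<^sup>2 + (l + r) = (r\<^sup>2 + r) + l * (l + (2 * r + 1))"
      by (simp add: power2_eq_square algebra_simps)
    moreover have "l + r + r + 1 = l + (2 * r + 1)" by simp
    moreover have "inv_qfac_diff q j (l + r) * inv_qfac_diff q (l + r) r = qbinom q M l / qfac q M"
      using qfac_nonzero[OF q, of M]
      by (cases "l \<le> M") (simp_all add: inv_qfac_diff_def j qbinom_eq_qfac[OF q] qbinom_eq_0)
    ultimately show ?thesis
      unfolding f_def by (simp only: power_add mult.assoc) simp
  qed
  have "((\<lambda>l. f (l + r)) has_sum (\<Sum>l\<le>M. f (l + r))) UNIV"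
    by (rule has_sum_finite_neutralI[where B = "{..M}"]) (auto simp: f qbinom_eq_0)
  also have "(\<Sum>l\<le>M. f (l + r)) = q ^ (r\<^sup>2 + r) / qfac q M * (1 / qfac q (M + (2 * r + 1)))"
    unfolding f sum_distrib_left[symmetric] qfac_convolution[OF q] ..
  also have "\<dots> = q ^ (r\<^sup>2 + r) * (inv_qfac_diff q j r / qfac q (j + r + 1))"
    by (simp add: inv_qfac_diff_def j mult_2 add_ac)
  finally have "((\<lambda>l. f (l + r)) has_sum \<dots>) UNIV" .
  thus ?thesis
    unfolding f_def[abs_def, symmetric]
    by (rule has_sum_nat_shift) (simp add: f_def inv_qfac_diff_def)
qed

text \<open>The recursion for bailey_seq is the transpose of the transformation in bailey_kernel_reproduces, so each
step multiplies the pairing with the kernel by $q^{r^2+r}$.\<close>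

lemma bailey_seq_transform:
  assumes q: "norm q < 1"
  shows "(\<Sum>\<^sub>\<infinity>i. q ^ i * (bailey_seq q k i * (inv_qfac_diff q i r / qfac q (i + r + 1))))
    = q ^ (Suc k * (r\<^sup>2 + r)) / qfac_inf q"
proof (induction k)
  case 0
  have "(\<Sum>\<^sub>\<infinity>i. q ^ i * (bailey_seq q 0 i * (inv_qfac_diff q i r / qfac q (i + r + 1))))
      = (\<Sum>\<^sub>\<infinity>i. q ^ (i\<^sup>2 + i) * inv_qfac_diff q i r / qfac q (i + r + 1))"
    by (intro infsum_cong) (simp add: power_add mult_ac)
  also have "\<dots> = q ^ (r\<^sup>2 + r) / qfac_inf q"
    by (rule infsumI[OF bailey_kernel_limit[OF q]])
  finally show ?case by simp
next
  case (Suc k)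
  obtain C where C: "C \<ge> 1" "\<And>n. norm (qfac q n) \<le> C" "\<And>n. norm (1 / qfac q n) \<le> C"
    using qfac_bounds[OF q] by blast
  obtain K where K: "\<And>i. norm (bailey_seq q k i) \<le> K"
    using bailey_seq_bounded[OF q] by blast
  have K0: "0 \<le> K" by (rule order.trans[OF norm_ge_zero K])
  define t where "t i j = q ^ (i\<^sup>2 + i) * inv_qfac_diff q j i * inv_qfac_diff q i r / qfac q (i + r + 1)"
    for i j
  define a where "a i j = q ^ j * bailey_seq q k j * t i j" for i j
  have bound: "norm (a i j) \<le> (K * (C * C * C)) * (norm q ^ i * norm q ^ j)" for i j
  proof -
    have "norm (inv_qfac_diff q j i * inv_qfac_diff q i r * (1 / qfac q (i + r + 1))) \<le> C * C * C"
      unfolding norm_mult using C inv_qfac_diff_bound[OF C(3)]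
      by (intro mult_mono mult_nonneg_nonneg) auto
    from power_weight_bound[OF q this, of i "i\<^sup>2 + i"]
    have "norm (t i j) \<le> (C * C * C) * norm q ^ i"
      by (simp add: t_def mult.assoc)
    moreover have "norm (q ^ j * bailey_seq q k j) \<le> K * norm q ^ j"
      by (rule power_weight_bound[OF q K]) simp
    ultimately have "norm (a i j) \<le> (K * norm q ^ j) * ((C * C * C) * norm q ^ i)"
      unfolding a_def norm_mult[of "q ^ j * bailey_seq q k j"] using K0
      by (intro mult_mono) auto
    thus ?thesis by (simp add: mult_ac)
  qed
  have "q ^ i * (bailey_seq q (Suc k) i * (inv_qfac_diff q i r / qfac q (i + r + 1))) = (\<Sum>\<^sub>\<infinity>j. a i j)" for i
  proof -
    have "a i j = (q ^ (i\<^sup>2 + i) * inv_qfac_diff q i r / qfac q (i + r + 1)) *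
                  (q ^ j * (bailey_seq q k j * inv_qfac_diff q j i))" for j
      by (simp add: a_def t_def)
    thus ?thesis
      by (simp only: infsum_cmult_right') (simp add: power_add)
  qed
  hence "(\<Sum>\<^sub>\<infinity>i. q ^ i * (bailey_seq q (Suc k) i * (inv_qfac_diff q i r / qfac q (i + r + 1))))
      = (\<Sum>\<^sub>\<infinity>i. \<Sum>\<^sub>\<infinity>j. a i j)" by simp
  also have "\<dots> = (\<Sum>\<^sub>\<infinity>j. \<Sum>\<^sub>\<infinity>i. a i j)"
    by (rule geometric_dominated_infsum_swap[OF _ q bound]) simp
  also have "\<dots> = (\<Sum>\<^sub>\<infinity>j. q ^ (r\<^sup>2 + r) *
      (q ^ j * (bailey_seq q k j * (inv_qfac_diff q j r / qfac q (j + r + 1)))))"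
  proof (rule infsum_cong)
    fix j
    have "infsum (\<lambda>i. t i j) UNIV = q ^ (r\<^sup>2 + r) * (inv_qfac_diff q j r / qfac q (j + r + 1))"
      unfolding t_def by (rule infsumI[OF bailey_kernel_reproduces[OF q]])
    thus "infsum (\<lambda>i. a i j) UNIV = q ^ (r\<^sup>2 + r) *
      (q ^ j * (bailey_seq q k j * (inv_qfac_diff q j r / qfac q (j + r + 1))))"
      by (simp add: a_def infsum_cmult_right')
  qed
  also have "\<dots> = q ^ (r\<^sup>2 + r) * (q ^ (Suc k * (r\<^sup>2 + r)) / qfac_inf q)"
    unfolding infsum_cmult_right' Suc.IH ..
  also have "\<dots> = q ^ (Suc (Suc k) * (r\<^sup>2 + r)) / qfac_inf q"
    by (simp add: power_add)
  finally show ?case .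
qed

lemma path_sum_odd:
  assumes q: "norm q < 1"
  shows "(path_step q ^^ (2 * k + 1)) (\<lambda>_. 1) 0
    = (\<Sum>\<^sub>\<infinity>r. q ^ r\<^sup>2 * (1 - q ^ (2 * r + 1)) * q ^ (Suc k * (r\<^sup>2 + r))) / qfac_inf q ^ (2 * k + 2)"
proof -
  obtain C where C: "C \<ge> 1" "\<And>n. norm (qfac q n) \<le> C" "\<And>n. norm (1 / qfac q n) \<le> C"
    using qfac_bounds[OF q] by blast
  obtain K where K: "\<And>i. norm (bailey_seq q k i) \<le> K"
    using bailey_seq_bounded[OF q] by blast
  have K0: "0 \<le> K" by (rule order.trans[OF norm_ge_zero K])
  define P where "P = qfac_inf q ^ (2 * k)"
  obtain B where B: "\<And>j. norm (bailey_seq q k j / (qfac q j)\<^sup>2 / P) \<le> B"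
    using bailey_seq_div_bounded[OF q] by blast
  define s where "s r = q ^ r\<^sup>2 * (1 - q ^ (2 * r + 1))" for r
  define a where "a j r = s r * (q ^ j * (bailey_seq q k j * (inv_qfac_diff q j r / qfac q (j + r + 1))))"
    for j r
  have bound: "norm (a j r) \<le> (2 * K * (C * C)) * (norm q ^ j * norm q ^ r)" for j r
  proof -
    have "norm (1 - q ^ (2 * r + 1)) \<le> 1 + norm (q ^ (2 * r + 1))"
      using norm_triangle_ineq4[of 1 "q ^ (2 * r + 1)"] by simp
    also have "\<dots> \<le> 2"
      using q power_le_one[of "norm q" "2 * r + 1"] by (simp add: norm_power del: power_Suc)
    finally have "norm (s r) \<le> 2 * norm q ^ r"
      unfolding s_def by (rule power_weight_bound[OF q]) (simp add: power2_eq_square)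
    moreover have "norm (bailey_seq q k j * (inv_qfac_diff q j r * (1 / qfac q (j + r + 1)))) \<le> K * (C * C)"
      unfolding norm_mult using C K K0 inv_qfac_diff_bound[OF C(3)]
      by (intro mult_mono mult_nonneg_nonneg) auto
    hence "norm (q ^ j * (bailey_seq q k j * (inv_qfac_diff q j r / qfac q (j + r + 1)))) \<le> K * (C * C) * norm q ^ j"
      by (intro power_weight_bound[OF q]) auto
    ultimately have "norm (a j r) \<le> (2 * norm q ^ r) * (K * (C * C) * norm q ^ j)"
      unfolding a_def norm_mult[of "s r"] by (intro mult_mono) auto
    thus ?thesis by (simp add: mult_ac)
  qed
  have inner: "(\<Sum>\<^sub>\<infinity>r. a j r) = q ^ j * (bailey_seq q k j / (qfac q j)\<^sup>2)" for j
  proof -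
    have "((\<lambda>r. a j r) has_sum (\<Sum>r\<le>j. a j r)) UNIV"
      by (rule has_sum_finite_neutralI[where B = "{..j}"]) (auto simp: a_def inv_qfac_diff_def)
    also have "(\<Sum>r\<le>j. a j r) = (\<Sum>r\<le>j. q ^ j * bailey_seq q k j *
        (q ^ r\<^sup>2 * (1 - q ^ (2 * r + 1)) / (qfac q (j - r) * qfac q (j + r + 1))))"
      by (intro sum.cong) (simp_all add: a_def s_def inv_qfac_diff_def)
    also have "\<dots> = q ^ j * bailey_seq q k j * (1 / (qfac q j)\<^sup>2)"
      unfolding sum_distrib_left[symmetric] inverse_qfac_square_bailey[OF q] ..
    finally show ?thesis by (simp add: infsumI)
  qed
  have "(path_step q ^^ (2 * k + 1)) (\<lambda>_. 1) 0
      = 1 / qfac_inf q * (\<Sum>\<^sub>\<infinity>j. q ^ j * (bailey_seq q k j / (qfac q j)\<^sup>2 / P))"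
    using path_step_expansion[OF q path_sum_expansion[OF q, of k, folded P_def] B, of 0]
    by simp
  also have "\<dots> = 1 / qfac_inf q * ((\<Sum>\<^sub>\<infinity>j. \<Sum>\<^sub>\<infinity>r. a j r) * (1 / P))"
    unfolding inner infsum_cmult_left'[symmetric] by simp
  also have "(\<Sum>\<^sub>\<infinity>j. \<Sum>\<^sub>\<infinity>r. a j r) = (\<Sum>\<^sub>\<infinity>r. \<Sum>\<^sub>\<infinity>j. a j r)"
    by (rule geometric_dominated_infsum_swap[OF _ q bound]) simp
  also have "\<dots> = (\<Sum>\<^sub>\<infinity>r. s r * q ^ (Suc k * (r\<^sup>2 + r)) * (1 / qfac_inf q))"
    unfolding a_def infsum_cmult_right' bailey_seq_transform[OF q] by simp
  also have "\<dots> = (\<Sum>\<^sub>\<infinity>r. s r * q ^ (Suc k * (r\<^sup>2 + r))) * (1 / qfac_inf q)"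
    by (rule infsum_cmult_left')
  finally show ?thesis
    by (simp add: s_def P_def power_add power2_eq_square)
qed

section \<open>Sums over tuples\<close>

text \<open>The summand for a path with $N$ vertices whose last vertex has a further neighbour carrying $m$. It
depends only on the values of $n$ on $\{1,\dots,N\}$. For $N = 0$ there is no vertex and the weight is $1$.\<close>

fun path_weight :: "complex \<Rightarrow> nat \<Rightarrow> nat \<Rightarrow> (nat \<Rightarrow> nat) \<Rightarrow> complex" where
  "path_weight q 0 m n = 1"
| "path_weight q (Suc N) m n =
     q ^ (n (Suc N) * Suc m) * (path_weight q N (n (Suc N)) n / (qfac q (n (Suc N)))\<^sup>2)"

lemma path_weight_upd: "N < j \<Longrightarrow> path_weight q N m (n(j := l)) = path_weight q N m n"
  by (induction N arbitrary: m) auto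

lemma path_weight_closed_form:
  "path_weight q N m n = q ^ ((\<Sum>i = 1..N - 1. n i * n (i + 1)) + (\<Sum>i = 1..N. n i)
      + (if N = 0 then 0 else n N * m)) / (\<Prod>i = 1..N. (qfac q (n i))\<^sup>2)"
proof (induction N arbitrary: m)
  case (Suc N)
  have "(\<Sum>i = 1..Suc N - 1. n i * n (i + 1))
      = (\<Sum>i = 1..N - 1. n i * n (i + 1)) + (if N = 0 then 0 else n N * n (Suc N))"
    by (cases N) simp_all
  thus ?case
    by (simp add: Suc.IH power_add del: One_nat_def) 
qed simp

lemma tuples_Suc_bij:
  "bij_betw (\<lambda>(l, n). n(Suc N := l)) (UNIV \<times> tuples N) (tuples (Suc N))"
proof -
  have "{1..Suc N} = insert (Suc N) {1..N}" by auto
  thus ?thesis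
    unfolding bij_betw_def tuples_def
    using inj_combinator[of "Suc N" "{1..N}" "\<lambda>_. UNIV"]
    by (simp add: PiE_insert_eq)
qed

lemma summable_on_tuples_prod:
  fixes r :: real
  assumes "0 \<le> r" "r < 1"
  shows "(\<lambda>n. \<Prod>i = 1..N. r ^ n i) summable_on tuples N"
proof (induction N)
  case 0
  show ?case by (simp add: tuples_def)
next
  case (Suc N)
  have "(\<lambda>(l, n). r ^ l * (\<Prod>i = 1..N. r ^ n i)) summable_on UNIV \<times> tuples N"
    using assms by (intro summable_on_product_nonneg geometric_summable_on Suc) (auto intro: prod_nonneg)
  also have "(\<lambda>(l, n). r ^ l * (\<Prod>i = 1..N. r ^ n i))
      = (\<lambda>x. (\<lambda>n. \<Prod>i = 1..Suc N. r ^ n i) ((\<lambda>(l, n). n(Suc N := l)) x))"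
    by (auto simp: fun_eq_iff mult.commute)
  finally show ?case
    by (subst (asm) summable_on_reindex_bij_betw[OF tuples_Suc_bij])
qed

lemma path_weight_summable:
  assumes q: "norm q < 1"
  shows "path_weight q N m summable_on tuples N"
proof -
  obtain C where C: "C \<ge> 1" "\<And>n. norm (qfac q n) \<le> C" "\<And>n. norm (1 / qfac q n) \<le> C"
    using qfac_bounds[OF q] by blast
  have bound: "norm (path_weight q N m n) \<le> (C * C) ^ N * (\<Prod>i = 1..N. norm q ^ n i)" for n
  proof (induction N arbitrary: m)
    case (Suc N)
    define l where "l = n (Suc N)"
    define x where "x = q ^ (l * Suc m) * (1 / (qfac q l)\<^sup>2)"
    have "norm (1 / qfac q l) * norm (1 / qfac q l) \<le> C * C"
      using C by (intro mult_mono) auto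
    hence "norm (1 / (qfac q l)\<^sup>2) \<le> C * C"
      by (simp add: power2_eq_square norm_divide norm_mult)
    hence "norm x \<le> C * C * norm q ^ l"
      unfolding x_def by (rule power_weight_bound[OF q]) simp
    hence "norm (x * path_weight q N l n)
        \<le> (C * C * norm q ^ l) * ((C * C) ^ N * (\<Prod>i = 1..N. norm q ^ n i))"
      unfolding norm_mult using C(1) Suc.IH[of l] by (intro mult_mono mult_nonneg_nonneg) auto
    moreover have "path_weight q (Suc N) m n = x * path_weight q N l n"
      by (simp add: l_def x_def)
    ultimately have "norm (path_weight q (Suc N) m n)
        \<le> (C * C * norm q ^ l) * ((C * C) ^ N * (\<Prod>i = 1..N. norm q ^ n i))"
      by simp
    thus ?case by (simp add: l_def mult_ac)
  qed simp
  have "(\<lambda>n. norm (path_weight q N m n)) summable_on tuples N"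
    by (rule Infinite_Sum.abs_summable_on_comparison_test'[OF _ bound])
       (intro summable_on_cmult_right summable_on_tuples_prod, use q in auto)
  thus ?thesis by (rule abs_summable_summable)
qed

text \<open>Splitting off the last coordinate of the tuple makes it the summation variable of one path_step.\<close>

lemma infsum_path_weight:
  assumes q: "norm q < 1"
  shows "infsum (path_weight q N m) (tuples N) = (path_step q ^^ N) (\<lambda>_. 1) m"
proof (induction N arbitrary: m)
  case 0
  show ?case by (simp add: tuples_def)
next
  case (Suc N)
  define g where "g = (\<lambda>x. path_weight q (Suc N) m ((\<lambda>(l, n). n(Suc N := l)) x))"
  have g: "g (l, n) = q ^ (l * Suc m) / (qfac q l)\<^sup>2 * path_weight q N l n" for l n
    by (simp add: g_def path_weight_upd)
  have summ: "g summable_on UNIV \<times> tuples N"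
    unfolding g_def summable_on_reindex_bij_betw[OF tuples_Suc_bij]
    by (rule path_weight_summable[OF q])
  have "infsum (path_weight q (Suc N) m) (tuples (Suc N)) = infsum g (UNIV \<times> tuples N)"
    unfolding g_def by (rule infsum_reindex_bij_betw[OF tuples_Suc_bij, symmetric])
  also have "\<dots> = (\<Sum>\<^sub>\<infinity>l. \<Sum>\<^sub>\<infinity>n\<in>tuples N. g (l, n))"
    by (rule infsum_Sigma_banach[OF summ, symmetric])
  also have "\<dots> = path_step q ((path_step q ^^ N) (\<lambda>_. 1)) m"
    unfolding path_step_def[of q "(path_step q ^^ N) (\<lambda>_. 1)"] g infsum_cmult_right' Suc.IH
    by simp
  finally show ?case
    unfolding funpow.simps o_def .
qed

lemma rhs_term_eq_path_weight:
  assumes "k \<ge> 1"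
  shows "rhs_term k q = path_weight q (2 * k - 1) 0"
  by (rule ext) (simp add: rhs_term_def path_weight_closed_form numeral_2_eq_2 del: One_nat_def)

section \<open>The false theta series\<close>

text \<open>The indices $r$ and $-r-1$ with $r\ge0$ are taken together.\<close>

lemma lhs_term_has_sum:
  assumes q: "norm q < 1"
  shows "(lhs_term k q has_sum (\<Sum>\<^sub>\<infinity>r. q ^ r\<^sup>2 * (1 - q ^ (2 * r + 1)) * q ^ (k * (r\<^sup>2 + r)))) UNIV"
proof -
  define a where "a r = q ^ (k * (r\<^sup>2 + r) + r\<^sup>2)" for r
  define b where "b r = - (q ^ (k * (r\<^sup>2 + r) + (r + 1)\<^sup>2))" for r
  have "norm (a r) \<le> 1 * norm q ^ r" for r
    using power_weight_bound[OF q, of 1 1 r "k * (r\<^sup>2 + r) + r\<^sup>2"]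
    by (simp add: a_def power2_eq_square trans_le_add2)
  hence a: "a summable_on UNIV"
    by (rule geometric_dominated_summable_on[OF norm_ge_zero q])
  have "norm (b r) \<le> 1 * norm q ^ r" for r
    using power_weight_bound[OF q, of "-1" 1 r "k * (r\<^sup>2 + r) + (r + 1)\<^sup>2"]
    by (simp add: b_def power2_eq_square trans_le_add2)
  hence b: "b summable_on UNIV"
    by (rule geometric_dominated_summable_on[OF norm_ge_zero q])
  have la: "lhs_term k q (int r) = a r" for r
  proof -
    have "(int k + 1) * (int r)\<^sup>2 + int k * int r = int (k * (r\<^sup>2 + r) + r\<^sup>2)"
      by (simp add: algebra_simps)
    thus ?thesis unfolding lhs_term_def a_def by (simp only: power_int_of_nat) (simp add: sg_def)
  qed
  have lb: "lhs_term k q (- int r - 1) = b r" for r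
  proof -
    have "(int k + 1) * (- int r - 1)\<^sup>2 + int k * (- int r - 1) = int (k * (r\<^sup>2 + r) + (r + 1)\<^sup>2)"
      by (simp add: algebra_simps power2_eq_square)
    thus ?thesis unfolding lhs_term_def b_def by (simp only: power_int_of_nat) (simp add: sg_def)
  qed
  have A: "(lhs_term k q has_sum infsum a UNIV) (range int)"
    using a by (subst has_sum_reindex) (auto simp: o_def la)
  have B: "(lhs_term k q has_sum infsum b UNIV) (range (\<lambda>r. - int r - 1))"
    using b by (subst has_sum_reindex) (auto simp: o_def lb inj_def)
  have disj: "range int \<inter> range (\<lambda>r. - int r - 1) = {}" by auto
  have "x \<in> range int \<union> range (\<lambda>r. - int r - 1)" for x :: int
  proof (cases "x \<ge> 0")
    case True
    hence "x = int (nat x)" by simp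
    thus ?thesis by blast
  next
    case False
    hence "x = - int (nat (- x - 1)) - 1" by simp
    thus ?thesis by blast
  qed
  hence U: "range int \<union> range (\<lambda>r. - int r - 1) = UNIV" by blast
  have "infsum a UNIV + infsum b UNIV = (\<Sum>\<^sub>\<infinity>r. a r + b r)"
    by (rule infsum_add[OF a b, symmetric])
  also have "\<dots> = (\<Sum>\<^sub>\<infinity>r. q ^ r\<^sup>2 * (1 - q ^ (2 * r + 1)) * q ^ (k * (r\<^sup>2 + r)))"
  proof (rule infsum_cong)
    fix r :: nat
    have "(r + 1)\<^sup>2 = r\<^sup>2 + (2 * r + 1)" by (simp add: power2_eq_square)
    thus "a r + b r = q ^ r\<^sup>2 * (1 - q ^ (2 * r + 1)) * q ^ (k * (r\<^sup>2 + r))"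
      unfolding a_def b_def by (simp only: power_add) (simp add: algebra_simps)
  qed
  finally show ?thesis
    using has_sum_Un_disjoint[OF A B disj] by (simp add: U)
qed

section \<open>The identity\<close>

theorem theorem5p1:
  fixes k :: nat and q :: complex
  assumes "k \<ge> 1" and "norm q < 1"
  shows "lhs_term k q summable_on UNIV \<and>
         rhs_term k q summable_on tuples (2 * k - 1) \<and>
         (\<Sum>\<^sub>\<infinity>n\<in>UNIV. lhs_term k q n) / qfac_inf q ^ (2 * k)
           = (\<Sum>\<^sub>\<infinity>n\<in>tuples (2 * k - 1). rhs_term k q n)"
proof (intro conjI)
  note q = \<open>norm q < 1\<close>
  note rhs = rhs_term_eq_path_weight[OF \<open>k \<ge> 1\<close>, of q]
  show "lhs_term k q summable_on UNIV"
    using lhs_term_has_sum[OF q] by (rule has_sum_imp_summable)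
  show "rhs_term k q summable_on tuples (2 * k - 1)"
    unfolding rhs by (rule path_weight_summable[OF q])
  obtain j where j: "k = Suc j"
    using \<open>k \<ge> 1\<close> by (cases k) auto
  have "(\<Sum>\<^sub>\<infinity>n\<in>tuples (2 * k - 1). rhs_term k q n) = (path_step q ^^ (2 * j + 1)) (\<lambda>_. 1) 0"
    unfolding rhs infsum_path_weight[OF q] by (simp add: j)
  also have "\<dots> = (\<Sum>\<^sub>\<infinity>n\<in>UNIV. lhs_term k q n) / qfac_inf q ^ (2 * k)"
    unfolding path_sum_odd[OF q] infsumI[OF lhs_term_has_sum[OF q]] by (simp add: j)
  finally show "(\<Sum>\<^sub>\<infinity>n\<in>UNIV. lhs_term k q n) / qfac_inf q ^ (2 * k)
      = (\<Sum>\<^sub>\<infinity>n\<in>tuples (2 * k - 1). rhs_term k q n)" ..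
qed

end
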